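(* Let $p\ge1$. The quasi-shuffle convolution logarithm of the identity, $\log^{*}(\mathrm{id})$, acts on the word $1\cdots p$ as $$\log^{*}(1\cdots p)=\sum_{\zeta\in\mathbb S_p'}\frac{(-1)^{\mathrm d(\zeta)}}{p}\binom{p-1}{\mathrm d(\zeta)}^{-1}\sigma(\zeta),$$ where $\mathbb S_p'$ is the set of all surjections from $\{1,\dots,p\}$ onto $\{1,\dots,q\}$ for some $q\le p$, $\mathrm d(\zeta)$ is the number of quasi-descents of $\zeta$, and $\sigma(\zeta)$ is the quasi-permutation associated with $\zeta$.
   Context: Letters and brackets. $\mathbb K$ is a field of characteristic zero. The letters $1,\dots,p$ generate freely a commutative associative bracket: let $\mathbb A$ be the free commutative semigroup on $\{1,\dots,p\}$, whose elements are written $[k_1,\dots,k_n]$ (order irrelevant, $[k]=k$), with $[\cdot,\cdot]$ the semigroup operation, extended bilinearly to the vector space $\mathbb K\mathbb A$. No nilpotency of the bracket is assumed. $\mathbb K\langle\mathbb A\rangle$ is the space of noncommutative polynomials (linear combinations of words) in letters from $\mathbb A$, and $1\cdots p$ is the word with successive letters $1,2,\dots,p$. Quasi-shuffle product $*$: bilinear, with the empty word as unit and, for words $u,v$ and letters $a,b$, $ua*vb=(u*vb)\,a+(ua*v)\,b+(u*v)\,[a,b]$. Logarithm: $\log^{*}(\mathrm{id})=\sum_{k\ge1}\frac{(-1)^{k-1}}kJ^{*k}$, where $J$ is the linear map sending every nonempty word to itself and the empty word to $0$, and $J^{*k}$ is its $k$-th quasi-shuffle convolution power; explicitly $J^{*k}(w)=\sum_{u_1\cdots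 u_k=w,\ u_i\text{ nonempty}}u_1*\cdots*u_k$. $\log^{*}(w)$ denotes $\log^{*}(\mathrm{id})$ applied to $w$. Surjections. A quasi-descent of $\zeta\in\mathbb S_p'$ is an index $k\in\{1,\dots,p-1\}$ with $\zeta(k+1)\le\zeta(k)$. For $\zeta\in\mathbb S_p'$ with image $\{1,\dots,q\}$, the quasi-permutation $\sigma(\zeta)$ is the word of length $q$ whose $j$-th letter is the bracket of all elements of $\zeta^{-1}(j)$ (so "letter $i$ is at position $\zeta(i)$ in $\sigma(\zeta)$"); e.g. $\sigma(3221)=4[2,3]1$. *)

theory Defs
  imports Complex_Main "HOL-Library.Multiset" "HOL-Library.FuncSet" "HOL-Library.Poly_Mapping"
begin

text \<open>
  The free commutative semigroup on a set of generators consists of the nonempty finite multisets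
  of generators; its operation, written \<open>+\<close> here, is the bracket \<open>[_, _]\<close>.
  A fixed infinite supply of generators is used, and the semigroup on \<open>1, \<dots>, p\<close> is the
  subsemigroup generated by these.
\<close>

typedef 'a letter = "{M :: 'a multiset. M \<noteq> {#}}"
  morphisms mset_letter bracket
  by (rule exI[of _ "{#undefined#}"]) simp

instantiation letter :: (type) ab_semigroup_add
begin

definition plus_letter :: "'a letter \<Rightarrow> 'a letter \<Rightarrow> 'a letter" where
  "a + b = bracket (mset_letter a + mset_letter b)"

instance
proof
  fix a b c :: "'a letter"
  have rep: "mset_letter (x + y) = mset_letter x + mset_letter y" for x y :: "'a letter"
    using mset_letter[of x] by (simp add: plus_letter_def bracket_inverse)
  show "a + b + c = a + (b + c)"
    by (simp add: mset_letter_inject[symmetric] rep add.assoc)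
  show "a + b = b + a"
    by (simp add: mset_letter_inject[symmetric] rep add.commute)
qed

end

definition gen :: "'a \<Rightarrow> 'a letter" where
  "gen x = bracket {#x#}"

text \<open>
  The space of noncommutative polynomials in the letters \<open>'a\<close> is \<open>'a list \<Rightarrow>\<^sub>0 'k\<close>. A linear map
  defined on it is represented by its values on the basis of words.
\<close>

type_synonym ('a, 'k) ncpoly = "'a list \<Rightarrow>\<^sub>0 'k"

abbreviation word :: "'a list \<Rightarrow> ('a, 'k::zero_neq_one) ncpoly" where
  "word w \<equiv> Poly_Mapping.single w 1"

definition scale :: "'k \<Rightarrow> ('w \<Rightarrow>\<^sub>0 'k::semiring_0) \<Rightarrow> ('w \<Rightarrow>\<^sub>0 'k)" where
  "scale c P = Poly_Mapping.map ((*) c) P"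

lemma lookup_scale: "Poly_Mapping.lookup (scale c P) w = c * Poly_Mapping.lookup P w"
  by (simp add: scale_def Poly_Mapping.map.rep_eq when_def)

lemma scale_0 [simp]: "scale c 0 = 0"
  by (rule poly_mapping_eqI) (simp add: lookup_scale)

definition linext :: "('v \<Rightarrow> ('w \<Rightarrow>\<^sub>0 'k::semiring_0)) \<Rightarrow> ('v \<Rightarrow>\<^sub>0 'k) \<Rightarrow> ('w \<Rightarrow>\<^sub>0 'k)" where
  "linext f P = (\<Sum>v\<in>Poly_Mapping.keys P. scale (Poly_Mapping.lookup P v) (f v))"

definition append_letter :: "('a, 'k::semiring_1) ncpoly \<Rightarrow> 'a \<Rightarrow> ('a, 'k) ncpoly" where
  "append_letter P a = linext (\<lambda>w. word (w @ [a])) P"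

text \<open>The quasi-shuffle product of two words, by recursion on their last letters.\<close>

function qshuffle :: "'a::ab_semigroup_add list \<Rightarrow> 'a list \<Rightarrow> ('a, 'k::semiring_1) ncpoly" where
  "qshuffle [] v = word v"
| "qshuffle (u @ [a]) [] = word (u @ [a])"
| "qshuffle (u @ [a]) (v @ [b]) =
     append_letter (qshuffle u (v @ [b])) a + append_letter (qshuffle (u @ [a]) v) b
       + append_letter (qshuffle u v) (a + b)"
proof -
  fix P :: bool and x :: "'a list \<times> 'a list"
  assume 1: "\<And>v. x = ([], v) \<Longrightarrow> P"
    and 2: "\<And>u a. x = (u @ [a], []) \<Longrightarrow> P"
    and 3: "\<And>u a v b. x = (u @ [a], v @ [b]) \<Longrightarrow> P"
  obtain s t where x: "x = (s, t)" by (cases x)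
  show P
    using 1 2 3 by (cases s rule: rev_cases; cases t rule: rev_cases) (auto simp: x)
qed auto
termination
  by (relation "measure (\<lambda>(u, v). length u + length v)") auto

definition qprod :: "('a::ab_semigroup_add, 'k::semiring_1) ncpoly \<Rightarrow> ('a, 'k) ncpoly \<Rightarrow> ('a, 'k) ncpoly"
    (infixl \<open>\<star>\<close> 70) where
  "P \<star> Q = linext (\<lambda>u. linext (\<lambda>v. qshuffle u v) Q) P"

text \<open>
  Convolution of linear endomorphisms with respect to the deconcatenation coproduct and the
  quasi-shuffle product; its unit is the projection onto the empty word.
\<close>

definition conv :: "('a list \<Rightarrow> ('a::ab_semigroup_add, 'k::semiring_1) ncpoly)
    \<Rightarrow> ('a list \<Rightarrow> ('a, 'k) ncpoly) \<Rightarrow> 'a list \<Rightarrow> ('a, 'k) ncpoly" where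
  "conv f g w = (\<Sum>i\<le>length w. f (take i w) \<star> g (drop i w))"

fun conv_pow :: "('a list \<Rightarrow> ('a::ab_semigroup_add, 'k::semiring_1) ncpoly) \<Rightarrow> nat
    \<Rightarrow> 'a list \<Rightarrow> ('a, 'k) ncpoly" where
  "conv_pow f 0 = (\<lambda>w. if w = [] then word [] else 0)"
| "conv_pow f (Suc k) = conv f (conv_pow f k)"

definition J :: "'a list \<Rightarrow> ('a, 'k::semiring_1) ncpoly" where
  "J w = (if w = [] then 0 else word w)"

text \<open>
  The series defining the logarithm is evaluated word by word. \<^const>\<open>Sum_any\<close> is the sum of the
  nonzero terms, provided that there are finitely many of them; see \<open>finite_log_terms\<close> below.
\<close>

definition log_id :: "'a::ab_semigroup_add list \<Rightarrow> ('a, 'k::field_char_0) ncpoly" where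
  "log_id w = Sum_any (\<lambda>k. if k \<ge> 1 then scale ((- 1) ^ (k - 1) / of_nat k) (conv_pow J k w) else 0)"

lemma conv_pow_J_eq_0:
  "length w < k \<Longrightarrow> conv_pow J k w = (0 :: ('a::ab_semigroup_add, 'k::semiring_1) ncpoly)"
proof (induction k arbitrary: w)
  case (Suc k)
  have "J (take i w) \<star> conv_pow J k (drop i w) = (0 :: ('a, 'k) ncpoly)" if "i \<le> length w" for i
  proof (cases "take i w = []")
    case True
    then show ?thesis by (simp add: J_def qprod_def linext_def)
  next
    case False
    then have "length (drop i w) < k" using Suc.prems that by auto
    then have "conv_pow J k (drop i w) = (0 :: ('a, 'k) ncpoly)" by (rule Suc.IH)
    then show ?thesis by (simp add: qprod_def linext_def)
  qed
  then show ?case by (simp add: conv_def)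
qed simp

lemma finite_log_terms:
  "finite {k. (if k \<ge> 1 then scale ((- 1) ^ (k - 1) / of_nat k) (conv_pow J k w) else 0)
      \<noteq> (0 :: ('a::ab_semigroup_add, 'k::field_char_0) ncpoly)}"
proof (rule finite_subset)
  show "{k. (if k \<ge> 1 then scale ((- 1) ^ (k - 1) / of_nat k) (conv_pow J k w) else 0)
      \<noteq> (0 :: ('a, 'k) ncpoly)} \<subseteq> {..length w}"
    by (auto split: if_splits) (metis conv_pow_J_eq_0 scale_0 not_le)
qed simp

text \<open>
  Maps defined on \<open>{1..p}\<close> are made unique as functions on \<^typ>\<open>nat\<close> by requiring them to be
  \<^const>\<open>undefined\<close> outside.
\<close>

definition surjections :: "nat \<Rightarrow> (nat \<Rightarrow> nat) set" where
  "surjections p = {\<zeta> \<in> extensional {1..p}. \<exists>q\<le>p. \<zeta> ` {1..p} = {1..q}}"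

definition quasi_descents :: "nat \<Rightarrow> (nat \<Rightarrow> nat) \<Rightarrow> nat set" where
  "quasi_descents p \<zeta> = {k \<in> {1..p - 1}. \<zeta> (k + 1) \<le> \<zeta> k}"

text \<open>For a surjection onto \<open>{1..q}\<close>, the number \<open>q\<close> is the cardinality of the image.\<close>

definition quasi_perm :: "nat \<Rightarrow> (nat \<Rightarrow> nat) \<Rightarrow> nat letter list" where
  "quasi_perm p \<zeta> =
     map (\<lambda>j. bracket (mset_set {i \<in> {1..p}. \<zeta> i = j})) [1..<Suc (card (\<zeta> ` {1..p}))]"

end

theory Submission
  imports Defs
begin

text \<open>
  The \<open>k\<close>-th convolution power of \<open>J\<close> cuts the word \<open>1 \<dots> p\<close> into \<open>k\<close> nonempty factors and
  quasi-shuffles them. The factors have no generator in common, so a word occurs in the product of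
  the factors at most once, and the quasi-permutation of a surjection \<open>\<zeta>\<close> occurs precisely if \<open>\<zeta>\<close> is
  strictly increasing on every factor, in other words if there is a cut at every quasi-descent of
  \<open>\<zeta>\<close>. The coefficient of the quasi-permutation in the \<open>k\<close>-th power is therefore the number of
  sets of \<open>k - 1\<close> cuts, chosen among the \<open>p - 1\<close> possible ones, which contain the quasi-descents
  (\<open>lookup_conv_pow_J\<close>).

  Its coefficient in the logarithm is then the sum of \<open>(- 1)\<^sup>|\<^sup>D\<^sup>| / (|D| + 1)\<close> over all sets \<open>D\<close> of
  cuts containing the \<open>d\<close> quasi-descents. This sum is the Beta integral
  \<open>\<integral>\<^sub>0\<^sup>1 (- x)\<^sup>d (1 - x)\<^sup>p\<^sup>-\<^sup>1\<^sup>-\<^sup>d dx = (- 1)\<^sup>d d! (p - 1 - d)! / p!\<close>, which is the stated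
  coefficient (\<open>sum_break_sets\<close>).

  The first step needs a description of products by coefficients. Restricting a word to a set \<open>A\<close> of
  generators deletes all other generators from its brackets. If \<open>P\<close> and \<open>Q\<close> involve disjoint sets of
  generators \<open>A\<close> and \<open>B\<close>, then the coefficient in \<open>P \<star> Q\<close> of a word over \<open>A \<union> B\<close> is the product of the
  coefficients in \<open>P\<close> and \<open>Q\<close> of its restrictions (\<open>lookup_qprod\<close>), and restricting the
  quasi-permutation of \<open>\<zeta>\<close> amounts to restricting the domain of \<open>\<zeta>\<close>
  (\<open>restrict_block_word\<close>). Finally, quasi-permutations are exactly the words using every generator
  once, so that words outside the sum have coefficient zero on both sides
  (\<open>bij_betw_quasi_perm\<close>, \<open>content_conv_pow_J\<close>).
\<close>

section \<open>Restricting words to a set of generators\<close>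
lemma mset_letter_neq_empty [simp]: "mset_letter l \<noteq> {#}"
  using mset_letter[of l] by simp

lemma mset_letter_bracket [simp]: "M \<noteq> {#} \<Longrightarrow> mset_letter (bracket M) = M"
  by (simp add: bracket_inverse)

lemma mset_letter_plus [simp]: "mset_letter (a + b) = mset_letter a + mset_letter b"
  by (simp add: plus_letter_def)

lemma letter_eq_iff: "a = b \<longleftrightarrow> mset_letter a = mset_letter b"
  by (simp add: mset_letter_inject)

definition over :: "'a set \<Rightarrow> 'a letter list \<Rightarrow> bool" where
  "over A w \<longleftrightarrow> (\<forall>l\<in>set w. set_mset (mset_letter l) \<subseteq> A)"

text \<open>
  The quasi-shuffle analogue of passing to the subword on the letters \<open>A\<close>; brackets that become
  empty are not letters and disappear.
\<close>
definition restrict_word :: "'a set \<Rightarrow> 'a letter list \<Rightarrow> 'a letter list" where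
  "restrict_word A w =
     map bracket (filter (\<lambda>M. M \<noteq> {#}) (map (\<lambda>l. filter_mset (\<lambda>x. x \<in> A) (mset_letter l)) w))"

definition content :: "'a letter list \<Rightarrow> 'a multiset" where
  "content w = (\<Sum>l\<leftarrow>w. mset_letter l)"

lemma restrict_word_Nil [simp]: "restrict_word A [] = []"
  by (simp add: restrict_word_def)

lemma restrict_word_snoc:
  "restrict_word A (w @ [c]) = restrict_word A w @
     (let M = filter_mset (\<lambda>x. x \<in> A) (mset_letter c) in if M = {#} then [] else [bracket M])"
  by (simp add: restrict_word_def Let_def)

lemma over_Nil [simp]: "over A []"
  by (simp add: over_def)

lemma over_mono: "over A w \<Longrightarrow> A \<subseteq> B \<Longrightarrow> over B w"
  by (auto simp: over_def)

lemma over_snoc [simp]: "over A (w @ [c]) \<longleftrightarrow> over A w \<and> set_mset (mset_letter c) \<subseteq> A"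
  by (auto simp: over_def)

lemma content_restrict_word: "content (restrict_word A w) = filter_mset (\<lambda>x. x \<in> A) (content w)"
  by (induction w) (simp_all add: content_def restrict_word_def)

lemma set_content: "set_mset (content w) = (\<Union>l\<in>set w. set_mset (mset_letter l))"
  by (induction w) (simp_all add: content_def)

lemma over_iff_content: "over A w \<longleftrightarrow> set_mset (content w) \<subseteq> A"
  by (auto simp: over_def set_content)

lemma restrict_word_id: "over A w \<Longrightarrow> restrict_word A w = w"
proof (induction w rule: rev_induct)
  case (snoc c w)
  then have "filter_mset (\<lambda>x. x \<in> A) (mset_letter c) = mset_letter c"
    by (auto simp: filter_mset_eq_conv)
  with snoc show ?case by (simp add: restrict_word_snoc mset_letter_inverse)
qed simp

lemma restrict_word_disjoint: "over B w \<Longrightarrow> A \<inter> B = {} \<Longrightarrow> restrict_word A w = []"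
proof (induction w rule: rev_induct)
  case (snoc c w)
  then have "filter_mset (\<lambda>x. x \<in> A) (mset_letter c) = {#}"
    by auto
  with snoc show ?case by (simp add: restrict_word_snoc)
qed simp

lemma filter_mset_Un_disjoint:
  assumes "A \<inter> B = {}" "set_mset M \<subseteq> A \<union> B"
  shows "filter_mset (\<lambda>x. x \<in> A) M + filter_mset (\<lambda>x. x \<in> B) M = M"
proof -
  have "M = filter_mset (\<lambda>x. x \<in> A) M + filter_mset (\<lambda>x. x \<notin> A) M" by (rule multiset_partition)
  moreover have "filter_mset (\<lambda>x. x \<notin> A) M = filter_mset (\<lambda>x. x \<in> B) M"
    using assms by (intro filter_mset_cong) auto
  ultimately show ?thesis by metis
qed

lemma over_restrict_eq:
  assumes "A \<inter> B = {}" "over (A \<union> B) w" "restrict_word B w = []"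
  shows "restrict_word A w = w"
proof (rule restrict_word_id)
  have "filter_mset (\<lambda>x. x \<in> B) (content w) = {#}"
    using content_restrict_word[of B w] assms by (simp add: content_def)
  then show "over A w" using assms(2) by (auto simp: over_iff_content)
qed

section \<open>Coefficients of quasi-shuffle products\<close>

lemma lookup_linext: "Poly_Mapping.lookup (linext f P) w =
    (\<Sum>v\<in>Poly_Mapping.keys P. Poly_Mapping.lookup P v * Poly_Mapping.lookup (f v) w)"
  by (simp add: linext_def lookup_sum lookup_scale)

lemma lookup_append_letter_Nil [simp]: "Poly_Mapping.lookup (append_letter P a) [] = 0"
  by (simp add: append_letter_def lookup_linext lookup_single)

lemma lookup_append_letter_snoc [simp]:
  "Poly_Mapping.lookup (append_letter P a) (w @ [c]) = (if c = a then Poly_Mapping.lookup P w else 0)"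
proof -
  have "Poly_Mapping.lookup (append_letter P a) (w @ [c]) =
     (\<Sum>v\<in>Poly_Mapping.keys P. if v = w then (if c = a then Poly_Mapping.lookup P v else 0) else 0)"
    unfolding append_letter_def lookup_linext
    by (intro sum.cong) (auto simp: lookup_single)
  then show ?thesis by (simp add: in_keys_iff)
qed

text \<open>
  A quasi-shuffle of \<open>u\<close> and \<open>v\<close> interleaves the two words and may merge a letter of \<open>u\<close> with a
  letter of \<open>v\<close>. If the generators of \<open>u\<close> and \<open>v\<close> are kept apart, each result remembers how it was
  produced, so every word occurs at most once, and it occurs exactly when its restrictions give back
  \<open>u\<close> and \<open>v\<close>. The three terms of the recursion correspond to the last letter \<open>c\<close> of the word
  lying over \<open>A\<close>, lying over \<open>B\<close>, or meeting both.
\<close>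
lemma lookup_qshuffle:
  assumes "A \<inter> B = {}" "over A u" "over B v"
  shows "Poly_Mapping.lookup (qshuffle u v :: ('a letter, 'k::semiring_1) ncpoly) w =
    (if over (A \<union> B) w \<and> restrict_word A w = u \<and> restrict_word B w = v then 1 else 0)"
  using assms(2,3)
proof (induction u v arbitrary: w rule: qshuffle.induct)
  case (1 v)
  have "over (A \<union> B) w \<and> restrict_word A w = [] \<and> restrict_word B w = v \<longleftrightarrow> w = v"
    using assms(1) 1 over_restrict_eq[of B A w, OF assms(1)[unfolded Int_commute[of A]]] restrict_word_id[of B v]
      restrict_word_disjoint[of B v A]
    by (auto simp: Un_commute over_def)
  then show ?case by (simp add: lookup_single when_def)
next
  case (2 u a)
  have "over (A \<union> B) w \<and> restrict_word A w = u @ [a] \<and> restrict_word B w = [] \<longleftrightarrow> w = u @ [a]"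
    using assms(1) 2 over_restrict_eq[of A B w] over_mono[of A "u @ [a]" "A \<union> B"] restrict_word_id[of A "u @ [a]"]
      restrict_word_disjoint[of A "u @ [a]" B]
    by (auto simp: Int_commute)
  then show ?case by (simp add: lookup_single when_def)
next
  case (3 u a v b)
  show ?case
  proof (cases w rule: rev_cases)
    case Nil
    then show ?thesis by (simp add: lookup_add)
  next
    case (snoc w' c)
    show ?thesis
    proof (cases "set_mset (mset_letter c) \<subseteq> A \<union> B")
      case False
      then have "c \<noteq> a" "c \<noteq> b" "c \<noteq> a + b" using 3(4,5) by auto
      with False show ?thesis by (simp add: snoc lookup_add)
    next
      case True
      define MA where "MA = filter_mset (\<lambda>x. x \<in> A) (mset_letter c)"
      define MB where "MB = filter_mset (\<lambda>x. x \<in> B) (mset_letter c)"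
      \<comment> \<open>A letter is determined by its parts over \<open>A\<close> and \<open>B\<close>; the last letter is tested against \<open>a\<close>, \<open>b\<close> and \<open>a + b\<close> through these.\<close>
      have c: "MA + MB = mset_letter c"
        using filter_mset_Un_disjoint[OF assms(1) True] by (simp add: MA_def MB_def)
      have aA: "filter_mset (\<lambda>x. x \<in> A) (mset_letter a) = mset_letter a"
           "filter_mset (\<lambda>x. x \<in> B) (mset_letter a) = {#}"
           "filter_mset (\<lambda>x. x \<in> B) (mset_letter b) = mset_letter b"
           "filter_mset (\<lambda>x. x \<in> A) (mset_letter b) = {#}"
        using 3(4,5) assms(1) by (auto simp: filter_mset_eq_conv)
      have c_eq: "c = l \<longleftrightarrow> MA = filter_mset (\<lambda>x. x \<in> A) (mset_letter l)
          \<and> MB = filter_mset (\<lambda>x. x \<in> B) (mset_letter l)"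
        if "set_mset (mset_letter l) \<subseteq> A \<union> B" for l
        using c filter_mset_Un_disjoint[OF assms(1) that] unfolding letter_eq_iff MA_def MB_def by metis
      have ca: "c = a \<longleftrightarrow> MA = mset_letter a \<and> MB = {#}"
        using c_eq[of a] 3(4) by (simp add: aA le_supI1)
      have cb: "c = b \<longleftrightarrow> MB = mset_letter b \<and> MA = {#}"
        using c_eq[of b] 3(5) by (simp add: aA le_supI2 conj_commute)
      have cab: "c = a + b \<longleftrightarrow> MA = mset_letter a \<and> MB = mset_letter b"
        using c_eq[of "a + b"] 3(4,5) by (simp add: aA le_supI1 le_supI2)
      have br: "bracket M = l \<longleftrightarrow> M = mset_letter l" if "M \<noteq> {#}" for M :: "'a multiset" and l
        using that by (simp add: letter_eq_iff)
      have rA: "restrict_word A w = u @ [a] \<longleftrightarrow>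
          (if MA = {#} then restrict_word A w' = u @ [a]
           else restrict_word A w' = u \<and> MA = mset_letter a)"
        using br[of MA a] unfolding snoc restrict_word_snoc MA_def[symmetric] Let_def
        by (cases "MA = {#}") simp_all
      have rB: "restrict_word B w = v @ [b] \<longleftrightarrow>
          (if MB = {#} then restrict_word B w' = v @ [b]
           else restrict_word B w' = v \<and> MB = mset_letter b)"
        using br[of MB b] unfolding snoc restrict_word_snoc MB_def[symmetric] Let_def
        by (cases "MB = {#}") simp_all
      have ow: "over (A \<union> B) w \<longleftrightarrow> over (A \<union> B) w'"
        using True by (simp add: snoc)
      have IH: "Poly_Mapping.lookup (qshuffle u (v @ [b]) :: ('a letter, 'k) ncpoly) w' =
         (if over (A \<union> B) w' \<and> restrict_word A w' = u \<and> restrict_word B w' = v @ [b] then 1 else 0)"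
        "Poly_Mapping.lookup (qshuffle (u @ [a]) v :: ('a letter, 'k) ncpoly) w' =
         (if over (A \<union> B) w' \<and> restrict_word A w' = u @ [a] \<and> restrict_word B w' = v then 1 else 0)"
        "Poly_Mapping.lookup (qshuffle u v :: ('a letter, 'k) ncpoly) w' =
         (if over (A \<union> B) w' \<and> restrict_word A w' = u \<and> restrict_word B w' = v then 1 else 0)"
        using 3 by auto
      have ne: "MA \<noteq> {#} \<or> MB \<noteq> {#}" using c by (metis add.right_neutral mset_letter_neq_empty)
      have "Poly_Mapping.lookup (qshuffle (u @ [a]) (v @ [b]) :: ('a letter, 'k) ncpoly) w =
         (if c = a \<and> over (A \<union> B) w' \<and> restrict_word A w' = u \<and> restrict_word B w' = v @ [b] then 1 else 0)
        + (if c = b \<and> over (A \<union> B) w' \<and> restrict_word A w' = u @ [a] \<and> restrict_word B w' = v then 1 else 0)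
        + (if c = a + b \<and> over (A \<union> B) w' \<and> restrict_word A w' = u \<and> restrict_word B w' = v then 1 else 0)"
        unfolding snoc qshuffle.simps lookup_add lookup_append_letter_snoc IH
        by (intro arg_cong2[where f = "(+)"]) simp_all
      also have "\<dots> = (if over (A \<union> B) w \<and> restrict_word A w = u @ [a] \<and> restrict_word B w = v @ [b] then 1 else 0)"
        unfolding rA rB ow ca cb cab using ne
        by (cases "MA = {#}"; cases "MB = {#}") simp_all
      finally show ?thesis .
    qed
  qed
qed

text \<open>
  By bilinearity: among the pairs of words in the supports, only the two restrictions of \<open>w\<close> have a
  quasi-shuffle containing \<open>w\<close>. Every coefficient of a convolution power is computed with this fact.
\<close>
lemma lookup_qprod:
  fixes P Q :: "('a letter, 'k::semiring_1) ncpoly"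
  assumes "A \<inter> B = {}"
    and P: "\<And>u. u \<in> Poly_Mapping.keys P \<Longrightarrow> over A u"
    and Q: "\<And>v. v \<in> Poly_Mapping.keys Q \<Longrightarrow> over B v"
  shows "Poly_Mapping.lookup (P \<star> Q) w =
    (if over (A \<union> B) w
     then Poly_Mapping.lookup P (restrict_word A w) * Poly_Mapping.lookup Q (restrict_word B w) else 0)"
proof -
  have "Poly_Mapping.lookup (P \<star> Q) w =
    (\<Sum>u\<in>Poly_Mapping.keys P. \<Sum>v\<in>Poly_Mapping.keys Q.
       (if u = restrict_word A w then Poly_Mapping.lookup P u else 0) *
       ((if v = restrict_word B w then Poly_Mapping.lookup Q v else 0) *
        (if over (A \<union> B) w then 1 else 0)))"
    unfolding qprod_def lookup_linext sum_distrib_left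
    by (intro sum.cong refl) (auto simp: lookup_qshuffle[OF assms(1) P Q])
  also have "\<dots> = Poly_Mapping.lookup P (restrict_word A w) *
     (Poly_Mapping.lookup Q (restrict_word B w) * (if over (A \<union> B) w then 1 else 0))"
    unfolding sum_distrib_left[symmetric] sum_distrib_right[symmetric]
    by (simp add: in_keys_iff)
  finally show ?thesis by simp
qed

section \<open>Quasi-permutations and restriction\<close>

text \<open>
  The quasi-permutation of an arbitrary map \<open>\<zeta>\<close> on an arbitrary set \<open>A\<close>: only the order of the
  values matters. Dropping the requirement that the values be \<open>1, \<dots>, q\<close> makes the construction
  compatible with restriction, since \<open>\<zeta>\<close> need not be renormalised on a smaller set.
\<close>
definition block_word :: "nat set \<Rightarrow> (nat \<Rightarrow> nat) \<Rightarrow> nat letter list" where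
  "block_word A \<zeta> =
     map (\<lambda>j. bracket (mset_set {i \<in> A. \<zeta> i = j})) (sorted_list_of_set (\<zeta> ` A))"

lemma block_word_image:
  "\<zeta> ` A = {1..q} \<Longrightarrow> block_word A \<zeta> = map (\<lambda>j. bracket (mset_set {i \<in> A. \<zeta> i = j})) [1..<Suc q]"
  by (simp only: block_word_def atLeastLessThanSuc_atLeastAtMost[symmetric] sorted_list_of_set_range)

lemma restrict_block_word:
  assumes "finite A"
  shows "restrict_word B (block_word A \<zeta>) = block_word (A \<inter> B) \<zeta>"
proof -
  let ?F = "\<lambda>j. filter_mset (\<lambda>x. x \<in> B) (mset_letter (bracket (mset_set {i \<in> A. \<zeta> i = j})))"
  have F: "?F j = mset_set {i \<in> A \<inter> B. \<zeta> i = j}" if "j \<in> \<zeta> ` A" for j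
  proof -
    have "mset_set {i \<in> A. \<zeta> i = j} \<noteq> {#}"
      using that assms by (auto simp: mset_set_empty_iff)
    then show ?thesis using assms by simp (metis (lifting) Int_iff)
  qed
  have F_ne: "?F j \<noteq> {#} \<longleftrightarrow> j \<in> \<zeta> ` (A \<inter> B)" if "j \<in> \<zeta> ` A" for j
    unfolding F[OF that] using assms by (auto simp: mset_set_empty_iff)
  have "filter (\<lambda>j. ?F j \<noteq> {#}) (sorted_list_of_set (\<zeta> ` A)) = sorted_list_of_set (\<zeta> ` (A \<inter> B))"
    using assms F_ne by (intro strict_sorted_equal) (auto simp: sorted_wrt_filter simp del: filter_mset_mset_set)
  then show ?thesis
    unfolding restrict_word_def block_word_def map_map filter_map o_def
    using assms F by (auto intro!: map_cong simp del: filter_mset_mset_set)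
qed

lemma content_block_word:
  assumes "finite A"
  shows "content (block_word A \<zeta>) = mset_set A"
proof -
  have "content (block_word A \<zeta>) = (\<Sum>j\<in>\<zeta> ` A. mset_letter (bracket (mset_set {i \<in> A. \<zeta> i = j})))"
    using assms by (simp add: content_def block_word_def o_def sum_list_distinct_conv_sum_set)
  also have "\<dots> = (\<Sum>j\<in>\<zeta> ` A. mset_set {i \<in> A. \<zeta> i = j})"
    using assms by (intro sum.cong refl mset_letter_bracket) (auto simp: mset_set_empty_iff)
  also have "\<dots> = mset_set A"
  proof (rule multiset_eqI)
    fix x
    have "count (\<Sum>j\<in>\<zeta> ` A. mset_set {i \<in> A. \<zeta> i = j}) x =
        (\<Sum>j\<in>\<zeta> ` A. if j = \<zeta> x then (if x \<in> A then 1 else 0) else 0)"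
      unfolding count_sum using assms by (intro sum.cong) (auto simp: count_mset_set')
    then show "count (\<Sum>j\<in>\<zeta> ` A. mset_set {i \<in> A. \<zeta> i = j}) x = count (mset_set A) x"
      using assms by (auto simp: count_mset_set')
  qed
  finally show ?thesis .
qed

text \<open>
  The word \<open>a (a + 1) \<dots> (b - 1)\<close> itself has all blocks of size one, in increasing order. Conversely
  this determines the block of each letter, hence the order of the values of \<open>\<zeta>\<close>.
\<close>
lemma block_word_eq_map_gen_iff:
  "block_word {a..<b} \<zeta> = map gen [a..<b] \<longleftrightarrow> strict_mono_on {a..<b} \<zeta>"
proof
  assume mono: "strict_mono_on {a..<b} \<zeta>"
  then have inj: "inj_on \<zeta> {a..<b}" by (rule strict_mono_on_imp_inj_on)
  have "sorted_list_of_set (\<zeta> ` {a..<b}) = map \<zeta> [a..<b]"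
    proof (rule strict_sorted_equal)
    show "sorted_wrt (<) (map \<zeta> [a..<b])"
      unfolding sorted_wrt_map
      by (rule sorted_wrt_mono_rel[OF _ sorted_wrt_upt])
        (use mono in \<open>auto simp: strict_mono_on_def\<close>)
  qed simp_all
  moreover have "{i \<in> {a..<b}. \<zeta> i = \<zeta> j} = {j}" if "j \<in> {a..<b}" for j
    using inj that by (auto simp: inj_on_def)
  ultimately show "block_word {a..<b} \<zeta> = map gen [a..<b]"
    by (simp add: block_word_def gen_def)
next
  assume eq: "block_word {a..<b} \<zeta> = map gen [a..<b]"
  define sl where "sl = sorted_list_of_set (\<zeta> ` {a..<b})"
  have len: "length sl = b - a"
    using arg_cong[OF eq, of length] by (simp add: block_word_def sl_def)
  have nth: "\<zeta> (a + n) = sl ! n" if n: "n < b - a" for n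
  proof -
    have "sl ! n \<in> \<zeta> ` {a..<b}"
      using nth_mem[of n sl] n len by (simp add: sl_def)
    then have ne: "mset_set {i \<in> {a..<b}. \<zeta> i = sl ! n} \<noteq> {#}"
      by (auto simp: mset_set_empty_iff)
    have "bracket (mset_set {i \<in> {a..<b}. \<zeta> i = sl ! n}) = gen (a + n)"
      using arg_cong[OF eq, of "\<lambda>w. w ! n"] n len by (simp add: block_word_def sl_def)
    then have "mset_set {i \<in> {a..<b}. \<zeta> i = sl ! n} = {#a + n#}"
      using ne by (simp add: gen_def bracket_inject)
    then have "a + n \<in># mset_set {i \<in> {a..<b}. \<zeta> i = sl ! n}" by simp
    then show ?thesis by simp
  qed
  have sorted: "sorted_wrt (<) sl" by (simp add: sl_def)
  show "strict_mono_on {a..<b} \<zeta>"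
  proof (rule strict_mono_onI)
    fix r s assume "r \<in> {a..<b}" "s \<in> {a..<b}" "r < s"
    then show "\<zeta> r < \<zeta> s"
      using nth[of "r - a"] nth[of "s - a"] sorted_wrt_nth_less[OF sorted, of "r - a" "s - a"] len
      by simp
  qed
qed

text \<open>
  The witness sends each generator to the position of the letter containing it. It is built by
  removing the last letter, whose generators all get the largest value.
\<close>
lemma block_word_surj:
  assumes "finite A" "content w = mset_set A"
  shows "\<exists>\<zeta>. \<zeta> \<in> extensional A \<and> \<zeta> ` A = {1..length w} \<and> block_word A \<zeta> = w"
  using assms
proof (induction w arbitrary: A rule: rev_induct)
  case Nil
  then have "A = {}" by (simp add: content_def mset_set_empty_iff)
  then show ?case by (auto simp: block_word_def)
next
  case (snoc c w)
  define C where "C = set_mset (mset_letter c)"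
  have sum: "content w + mset_letter c = mset_set A"
    using snoc.prems by (simp add: content_def)
  have count: "count (content w) x + count (mset_letter c) x = (if x \<in> A then 1 else 0)" for x
    using arg_cong[OF sum, of "\<lambda>M. count M x"] snoc.prems(1) by (simp add: count_mset_set')
  have C: "C \<subseteq> A" "finite C"
    using count by (force simp: C_def simp flip: count_greater_zero_iff split: if_splits)+
  \<comment> \<open>No generator is repeated, so the last letter is the bracket of a set.\<close>
  have c: "mset_letter c = mset_set C"
  proof (rule multiset_eqI)
    fix x show "count (mset_letter c) x = count (mset_set C) x"
      using count[of x] by (auto simp: C_def count_mset_set' not_in_iff split: if_splits simp flip: count_greater_zero_iff)
  qed
  have "C \<noteq> {}" by (simp add: C_def)
  have w: "content w = mset_set (A - C)"
    using sum c C snoc.prems(1) by (metis add_diff_cancel_right' mset_set_Diff)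
  obtain \<zeta>' where \<zeta>': "\<zeta>' \<in> extensional (A - C)" "\<zeta>' ` (A - C) = {1..length w}"
      "block_word (A - C) \<zeta>' = w"
    using snoc.IH[OF _ w] snoc.prems(1) by auto
  define \<zeta> where "\<zeta> = (\<lambda>i. if i \<in> C then Suc (length w) else \<zeta>' i)"
  have img: "\<zeta> ` A = {1..Suc (length w)}"
  proof -
    have "\<zeta> ` A = \<zeta> ` C \<union> \<zeta> ` (A - C)" using C by auto
    also have "\<zeta> ` C = {Suc (length w)}" using \<open>C \<noteq> {}\<close> by (auto simp: \<zeta>_def)
    also have "\<zeta> ` (A - C) = {1..length w}"
      unfolding \<zeta>'(2)[symmetric] by (auto simp: \<zeta>_def)
    finally show ?thesis by auto
  qed
  have fib: "{i \<in> A. \<zeta> i = j} = {i \<in> A - C. \<zeta>' i = j}" if "j \<in> {1..length w}" for j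
    using that by (auto simp: \<zeta>_def)
  have "\<zeta>' i \<noteq> Suc (length w)" if "i \<in> A - C" for i
  proof -
    have "\<zeta>' i \<in> {1..length w}" using that \<zeta>'(2) by blast
    then show ?thesis by simp
  qed
  then have "{i \<in> A. \<zeta> i = Suc (length w)} = C"
    using C by (auto simp: \<zeta>_def split: if_splits)
  then have "block_word A \<zeta> = block_word (A - C) \<zeta>' @ [c]"
    unfolding block_word_image[OF img] block_word_image[OF \<zeta>'(2)]
    using fib c[symmetric] by (auto simp: mset_letter_inverse simp del: upt_Suc simp add: upt_Suc_append)
  then show ?case
    using img \<zeta>' C by (intro exI[of _ \<zeta>]) (auto simp: \<zeta>_def extensional_def)
qed

lemma block_word_inj:
  assumes "finite A" "\<zeta> \<in> extensional A" "\<xi> \<in> extensional A"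
    "\<zeta> ` A = {1..q}" "\<xi> ` A = {1..r}" "block_word A \<zeta> = block_word A \<xi>"
  shows "\<zeta> = \<xi>"
proof (rule extensionalityI[OF assms(2,3)])
  fix i assume i: "i \<in> A"
  note eq = assms(6)[unfolded block_word_image[OF assms(4)] block_word_image[OF assms(5)]]
  have [simp]: "r = q" using arg_cong[OF eq, of length] by (simp del: upt_Suc)
  define j where "j = \<zeta> i"
  have j: "j \<in> {1..q}" using i assms(4) by (auto simp: j_def)
  then have "bracket (mset_set {i \<in> A. \<zeta> i = j}) = bracket (mset_set {i \<in> A. \<xi> i = j})"
    using eq by (auto simp: map_eq_conv)
  moreover have "mset_set {i \<in> A. \<zeta> i = j} \<noteq> {#}" "mset_set {i \<in> A. \<xi> i = j} \<noteq> {#}"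
  proof -
    have "j \<in> \<zeta> ` A" "j \<in> \<xi> ` A" using j assms(4,5) by auto
    then show "mset_set {i \<in> A. \<zeta> i = j} \<noteq> {#}" "mset_set {i \<in> A. \<xi> i = j} \<noteq> {#}"
      using assms(1) by (auto simp: mset_set_empty_iff)
  qed
  ultimately have "{i \<in> A. \<zeta> i = j} = {i \<in> A. \<xi> i = j}"
    using assms(1) by (simp add: bracket_inject)
  moreover have "i \<in> {i \<in> A. \<zeta> i = j}" using i by (simp add: j_def)
  ultimately show "\<zeta> i = \<xi> i" by (simp add: j_def)
qed

section \<open>Cutting a word at its quasi-descents\<close>

text \<open>
  A quasi-descent \<open>k\<close> is recorded here by the letter \<open>c = k + 1\<close>. When the word
  \<open>a (a + 1) \<dots> (b - 1)\<close> is cut into factors on which \<open>\<zeta>\<close> is strictly increasing, a new factor must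
  begin with this letter.
\<close>
definition forced_breaks :: "nat \<Rightarrow> nat \<Rightarrow> (nat \<Rightarrow> nat) \<Rightarrow> nat set" where
  "forced_breaks a b \<zeta> = {c \<in> {a<..<b}. \<zeta> c \<le> \<zeta> (c - 1)}"

lemma strict_mono_on_iff_no_forced_break: "strict_mono_on {a..<b} \<zeta> \<longleftrightarrow> forced_breaks a b \<zeta> = {}"
proof
  assume "strict_mono_on {a..<b} \<zeta>"
  then have "\<zeta> (c - 1) < \<zeta> c" if "c \<in> {a<..<b}" for c
    by (rule strict_mono_onD) (use that in auto)
  then have "\<not> \<zeta> c \<le> \<zeta> (c - 1)" if "c \<in> {a<..<b}" for c
    using that by (simp only: not_le)
  then show "forced_breaks a b \<zeta> = {}" by (auto simp: forced_breaks_def)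
next
  assume D: "forced_breaks a b \<zeta> = {}"
  have step: "\<zeta> i < \<zeta> (Suc i)" if "a \<le> i" "Suc i < b" for i
  proof -
    have "Suc i \<notin> forced_breaks a b \<zeta>" using D by simp
    with that show ?thesis by (auto simp: forced_breaks_def)
  qed
  have "\<zeta> r < \<zeta> s" if "r < s" "a \<le> r" "s < b" for r s
    using that
  proof (induction s)
    case (Suc s)
    show ?case
    proof (cases "r = s")
      case True
      then show ?thesis using step[of s] Suc.prems by simp
    next
      case False
      then have "\<zeta> r < \<zeta> s" using Suc by simp
      also have "\<zeta> s < \<zeta> (Suc s)" using step[of s] Suc.prems by simp
      finally show ?thesis .
    qed
  qed simp
  then show "strict_mono_on {a..<b} \<zeta>" by (auto intro!: strict_mono_onI)
qed

text \<open>
  The admissible ways of cutting the word into \<open>k + 1\<close> nonempty factors, each given by the set of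
  the first letters of all factors but the first.
\<close>
definition break_sets :: "nat \<Rightarrow> nat \<Rightarrow> nat \<Rightarrow> (nat \<Rightarrow> nat) \<Rightarrow> nat set set" where
  "break_sets k a b \<zeta> = {D. forced_breaks a b \<zeta> \<subseteq> D \<and> D \<subseteq> {a<..<b} \<and> card D = k}"

lemma finite_break_sets: "finite (break_sets k a b \<zeta>)"
  by (rule finite_subset[of _ "Pow {a<..<b}"]) (auto simp: break_sets_def)

lemma break_sets_0: "break_sets 0 a b \<zeta> = (if forced_breaks a b \<zeta> = {} then {{}} else {})"
proof -
  have "D = {}" if "D \<subseteq> {a<..<b}" "card D = 0" for D
    using that finite_subset[OF that(1)] by auto
  then show ?thesis by (auto simp: break_sets_def)
qed

text \<open>
  Splitting off the first factor: \<open>m\<close> is the letter that begins the second factor, which is the least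
  element of the break set.
\<close>
lemma break_sets_Suc:
  "break_sets (Suc k) a b \<zeta> =
    (\<Union>m\<in>{m \<in> {a<..<b}. forced_breaks a m \<zeta> = {}}. insert m ` break_sets k m b \<zeta>)" (is "?L = ?R")
proof (intro equalityI subsetI)
  fix D assume "D \<in> ?L"
  then have D: "forced_breaks a b \<zeta> \<subseteq> D" "D \<subseteq> {a<..<b}" "card D = Suc k"
    by (auto simp: break_sets_def)
  have fin: "finite D" and ne: "D \<noteq> {}"
    using D(3) card.infinite by fastforce+
  define m where "m = Min D"
  have m: "m \<in> D" "\<And>x. x \<in> D \<Longrightarrow> m \<le> x" using fin ne by (auto simp: m_def)
  have m_range: "m \<in> {a<..<b}" using D(2) m(1) by blast
  have "D - {m} \<in> break_sets k m b \<zeta>"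
    unfolding break_sets_def
  proof (intro CollectI conjI)
    have "forced_breaks m b \<zeta> \<subseteq> forced_breaks a b \<zeta>" "m \<notin> forced_breaks m b \<zeta>"
      using m_range by (auto simp: forced_breaks_def)
    then show "forced_breaks m b \<zeta> \<subseteq> D - {m}" using D(1) by blast
    show "D - {m} \<subseteq> {m<..<b}"
    proof
      fix x assume "x \<in> D - {m}"
      then show "x \<in> {m<..<b}" using m(2)[of x] D(2) by auto
    qed
    show "card (D - {m}) = k" using D(3) m(1) fin by simp
  qed
  moreover note m_range
  moreover have "forced_breaks a m \<zeta> = {}"
  proof -
    have "c \<notin> forced_breaks a m \<zeta>" for c
    proof
      assume c: "c \<in> forced_breaks a m \<zeta>"
      then have "c \<in> D" using D(1) m_range by (auto simp: forced_breaks_def)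
      with m(2)[of c] c show False by (auto simp: forced_breaks_def)
    qed
    then show ?thesis by blast
  qed
  ultimately show "D \<in> ?R" using m(1) by (auto intro!: bexI[of _ m] image_eqI[of _ _ "D - {m}"])
next
  fix D assume "D \<in> ?R"
  then obtain m D' where m: "m \<in> {a<..<b}" "forced_breaks a m \<zeta> = {}"
    and D': "D' \<in> break_sets k m b \<zeta>" and D: "D = insert m D'" by auto
  have "finite D'" "m \<notin> D'"
    using D' finite_subset[of D' "{m<..<b}"] by (auto simp: break_sets_def)
  moreover have "forced_breaks a b \<zeta> \<subseteq> insert m (forced_breaks m b \<zeta>)"
    using m by (auto simp: forced_breaks_def) (metis nat_neq_iff)
  ultimately show "D \<in> ?L" using m D' by (auto simp: break_sets_def D)
qed

lemma card_break_sets_Suc: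
  "card (break_sets (Suc k) a b \<zeta>) =
    (\<Sum>m\<in>{a<..<b}. if forced_breaks a m \<zeta> = {} then card (break_sets k m b \<zeta>) else 0)"
proof -
  have inj: "inj_on (insert m) (break_sets k m b \<zeta>)" for m
  proof (rule inj_onI)
    fix D E assume "D \<in> break_sets k m b \<zeta>" "E \<in> break_sets k m b \<zeta>" "insert m D = insert m E"
    moreover from this have "m \<notin> D" "m \<notin> E" by (auto simp: break_sets_def)
    ultimately show "D = E" by (simp add: insert_ident)
  qed
  have min: "m \<le> x" if "D \<in> insert m ` break_sets k m b \<zeta>" "x \<in> D" for m x :: nat and D
    using that by (auto simp: break_sets_def)
  have "card (break_sets (Suc k) a b \<zeta>) =
      (\<Sum>m\<in>{m \<in> {a<..<b}. forced_breaks a m \<zeta> = {}}. card (insert m ` break_sets k m b \<zeta>))"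
    unfolding break_sets_Suc
  proof (intro card_UN_disjoint ballI impI)
    fix m n :: nat assume "m \<noteq> n"
    show "insert m ` break_sets k m b \<zeta> \<inter> insert n ` break_sets k n b \<zeta> = {}"
    proof (rule ccontr)
      assume "insert m ` break_sets k m b \<zeta> \<inter> insert n ` break_sets k n b \<zeta> \<noteq> {}"
      then obtain D where D: "D \<in> insert m ` break_sets k m b \<zeta>" "D \<in> insert n ` break_sets k n b \<zeta>"
        by auto
      then have "m \<in> D" "n \<in> D" by auto
      then have "m = n" using min[OF D(1)] min[OF D(2)] by (meson le_antisym)
      with \<open>m \<noteq> n\<close> show False by simp
    qed
  qed (auto simp: finite_break_sets)
  also have "\<dots> = (\<Sum>m\<in>{m \<in> {a<..<b}. forced_breaks a m \<zeta> = {}}. card (break_sets k m b \<zeta>))"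
    by (simp add: card_image[OF inj])
  also have "\<dots> = (\<Sum>m\<in>{a<..<b}. if forced_breaks a m \<zeta> = {} then card (break_sets k m b \<zeta>) else 0)"
    by (rule sum.inter_filter) simp
  finally show ?thesis .
qed

section \<open>Convolution powers of \<open>J\<close> on a word of distinct generators\<close>
lemma content_map_gen: "content (map gen xs) = mset xs"
  by (induction xs) (simp_all add: content_def gen_def)

text \<open>
  Serves to confine the support of convolution powers to quasi-permutations. Since both restrictions
  of \<open>w\<close> lie in the supports of the factors, their contents are known, and they add up to that of
  \<open>w\<close>.
\<close>
lemma content_qprod:
  fixes P Q :: "('a letter, 'k::semiring_1) ncpoly"
  assumes "finite A" "finite B" "A \<inter> B = {}"
    and P: "\<And>u. u \<in> Poly_Mapping.keys P \<Longrightarrow> content u = mset_set A"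
    and Q: "\<And>v. v \<in> Poly_Mapping.keys Q \<Longrightarrow> content v = mset_set B"
    and w: "w \<in> Poly_Mapping.keys (P \<star> Q)"
  shows "content w = mset_set (A \<union> B)"
proof -
  have lookup: "Poly_Mapping.lookup (P \<star> Q) w =
      (if over (A \<union> B) w
       then Poly_Mapping.lookup P (restrict_word A w) * Poly_Mapping.lookup Q (restrict_word B w) else 0)"
    using assms by (intro lookup_qprod) (auto simp: over_iff_content)
  have "Poly_Mapping.lookup (P \<star> Q) w \<noteq> 0"
    using w by (simp add: in_keys_iff)
  then have ov: "over (A \<union> B) w" and "Poly_Mapping.lookup P (restrict_word A w) \<noteq> 0"
      "Poly_Mapping.lookup Q (restrict_word B w) \<noteq> 0"
    unfolding lookup by (auto split: if_splits)
  then have "content (restrict_word A w) = mset_set A" "content (restrict_word B w) = mset_set B"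
    by (simp_all add: P Q in_keys_iff)
  then show ?thesis
    using filter_mset_Un_disjoint[OF assms(3), of "content w"] ov assms(1-3)
    by (simp add: content_restrict_word over_iff_content mset_set_Union)
qed

lemma qprod_0_left [simp]: "0 \<star> Q = 0"
  by (simp add: qprod_def linext_def)

lemma qprod_0_right [simp]: "P \<star> 0 = 0"
  by (simp add: qprod_def linext_def)

text \<open>
  Cuts of the word are indexed by the first letter \<open>m\<close> of the right factor instead of by the length of
  the left one, to match break sets.
\<close>
lemma conv_pow_J_map_gen:
  assumes "a \<le> b"
  shows "conv_pow J (Suc k) (map gen [a..<b]) =
    (\<Sum>m\<in>{a..b}. J (map gen [a..<m]) \<star> conv_pow J k (map gen [m..<b]))"
  unfolding conv_pow.simps conv_def
  by (rule sum.reindex_bij_witness[of _ "\<lambda>m. m - a" "\<lambda>i. a + i"])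
    (use assms in \<open>auto simp: take_map drop_map simp del: map_map\<close>)

lemma content_conv_pow_J:
  assumes "a \<le> b" "w \<in> Poly_Mapping.keys (conv_pow J k (map gen [a..<b]) :: (nat letter, 'k::semiring_1) ncpoly)"
  shows "content w = mset_set {a..<b}"
  using assms
proof (induction k arbitrary: a w)
  case 0
  then show ?case by (auto simp: content_def split: if_splits)
next
  case (Suc k)
  let ?t = "\<lambda>m. J (map gen [a..<m]) \<star> conv_pow J k (map gen [m..<b]) :: (nat letter, 'k) ncpoly"
  have "w \<in> Poly_Mapping.keys (\<Sum>m\<in>{a..b}. ?t m)"
    using Suc.prems(2) by (simp only: conv_pow_J_map_gen[OF Suc.prems(1)])
  then obtain m where m: "m \<in> {a..b}" "w \<in> Poly_Mapping.keys (?t m)"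
    using keys_sum[of ?t "{a..b}"] by blast
  have "content w = mset_set ({a..<m} \<union> {m..<b})"
  proof (rule content_qprod[OF _ _ _ _ _ m(2)])
    fix u assume "u \<in> Poly_Mapping.keys (J (map gen [a..<m]) :: (nat letter, 'k) ncpoly)"
    then have "u = map gen [a..<m]" by (auto simp: J_def split: if_splits)
    then show "content u = mset_set {a..<m}" by (simp add: content_map_gen)
  next
    fix v assume "v \<in> Poly_Mapping.keys (conv_pow J k (map gen [m..<b]) :: (nat letter, 'k) ncpoly)"
    then show "content v = mset_set {m..<b}" using Suc.IH m by auto
  qed auto
  also have "{a..<m} \<union> {m..<b} = {a..<b}" using m by auto
  finally show ?case .
qed

lemma lookup_J_block_word:
  assumes "a < b"
  shows "Poly_Mapping.lookup (J (map gen [a..<b]) :: (nat letter, 'k::semiring_1) ncpoly) (block_word {a..<b} \<zeta>) =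
    (if forced_breaks a b \<zeta> = {} then 1 else 0)"
  using assms block_word_eq_map_gen_iff[of a b \<zeta>]
  by (auto simp: J_def lookup_single when_def strict_mono_on_iff_no_forced_break)

lemma qprod_word_Nil: "word u \<star> word [] = (word u :: ('a::ab_semigroup_add, 'k::semiring_1) ncpoly)"
proof (rule poly_mapping_eqI)
  fix w
  show "Poly_Mapping.lookup (word u \<star> word []) w = Poly_Mapping.lookup (word u :: ('a, 'k) ncpoly) w"
    by (cases u rule: rev_cases) (simp_all add: qprod_def lookup_linext)
qed

lemma conv_pow_J_1: "conv_pow J (Suc 0) u = J u"
proof (cases "u = []")
  case True
  then show ?thesis by (simp add: conv_def J_def)
next
  case False
  have "conv_pow J (Suc 0) u =
      (\<Sum>i\<le>length u. if i = length u then J u \<star> word [] else 0)"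
    unfolding conv_pow.simps conv_def by (intro sum.cong) auto
  also have "\<dots> = J u" using False by (simp add: J_def qprod_word_Nil)
  finally show ?thesis .
qed

text \<open>
  Expanding the convolution power cuts the word into \<open>k + 1\<close> nonempty factors and quasi-shuffles them;
  the quasi-permutation of \<open>\<zeta>\<close> occurs in the product, once, exactly when \<open>\<zeta>\<close> increases strictly on
  every factor. The induction mirrors the recursion for break sets.
\<close>
lemma lookup_conv_pow_J:
  assumes "a < b"
  shows "Poly_Mapping.lookup (conv_pow J (Suc k) (map gen [a..<b]) :: (nat letter, 'k::semiring_1) ncpoly)
      (block_word {a..<b} \<zeta>) = of_nat (card (break_sets k a b \<zeta>))"
  using assms
proof (induction k arbitrary: a)
  case 0
  then show ?case by (simp only: conv_pow_J_1 lookup_J_block_word) (simp add: break_sets_0)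
next
  case (Suc k)
  let ?w = "block_word {a..<b} \<zeta>"
  let ?t = "\<lambda>m. J (map gen [a..<m]) \<star> conv_pow J (Suc k) (map gen [m..<b]) :: (nat letter, 'k) ncpoly"
  have "Poly_Mapping.lookup (conv_pow J (Suc (Suc k)) (map gen [a..<b]) :: (nat letter, 'k) ncpoly) ?w
      = (\<Sum>m\<in>{a..b}. Poly_Mapping.lookup (?t m) ?w)"
    by (simp only: conv_pow_J_map_gen[OF less_imp_le[OF Suc.prems]] lookup_sum)
  also have "\<dots> = (\<Sum>m\<in>{a<..<b}. Poly_Mapping.lookup (?t m) ?w)"
  proof (rule sum.mono_neutral_right)
    \<comment> \<open>The cuts at the two ends leave an empty factor, on which \<open>J\<close> and its positive powers vanish.\<close>
    have "?t m = 0" if "m \<in> {a..b} - {a<..<b}" for m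
    proof -
      have "m = a \<or> m = b" using that by auto
      then show ?thesis
      proof
        assume "m = a"
        then show ?thesis by (simp add: J_def del: conv_pow.simps)
      next
        assume "m = b"
        then show ?thesis by (simp add: conv_pow_J_eq_0 del: conv_pow.simps)
      qed
    qed
    then show "\<forall>m\<in>{a..b} - {a<..<b}. Poly_Mapping.lookup (?t m) ?w = 0"
      by (simp del: conv_pow.simps)
  qed auto
  also have "\<dots> = (\<Sum>m\<in>{a<..<b}. of_nat (if forced_breaks a m \<zeta> = {} then card (break_sets k m b \<zeta>) else 0))"
  proof (rule sum.cong)
    fix m assume m: "m \<in> {a<..<b}"
    \<comment> \<open>The coefficient factors into one for \<open>a, \<dots>, m - 1\<close> and one for \<open>m, \<dots>, b - 1\<close>.\<close>
    have un: "{a..<m} \<union> {m..<b} = {a..<b}" and int: "{a..<b} \<inter> {a..<m} = {a..<m}"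
        "{a..<b} \<inter> {m..<b} = {m..<b}" using m by auto
    have ov: "over {a..<b} ?w" by (simp add: over_iff_content content_block_word)
    have "Poly_Mapping.lookup (?t m) ?w =
        (if over ({a..<m} \<union> {m..<b}) ?w
         then Poly_Mapping.lookup (J (map gen [a..<m]) :: (nat letter, 'k) ncpoly) (restrict_word {a..<m} ?w) *
           Poly_Mapping.lookup (conv_pow J (Suc k) (map gen [m..<b]) :: (nat letter, 'k) ncpoly)
             (restrict_word {m..<b} ?w) else 0)"
    proof (rule lookup_qprod)
      fix u assume "u \<in> Poly_Mapping.keys (J (map gen [a..<m]) :: (nat letter, 'k) ncpoly)"
      then have "u = map gen [a..<m]" by (auto simp: J_def split: if_splits)
      then show "over {a..<m} u" by (simp add: over_iff_content content_map_gen)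
    next
      fix v assume "v \<in> Poly_Mapping.keys (conv_pow J (Suc k) (map gen [m..<b]) :: (nat letter, 'k) ncpoly)"
      then have "content v = mset_set {m..<b}" by (rule content_conv_pow_J[rotated]) (use m in auto)
      then show "over {m..<b} v" by (simp add: over_iff_content)
    qed auto
    also have "\<dots> = (if forced_breaks a m \<zeta> = {} then 1 else 0) * of_nat (card (break_sets k m b \<zeta>))"
      unfolding un restrict_block_word[OF finite_atLeastLessThan] int
      using ov m Suc.IH[of m] by (simp add: lookup_J_block_word del: conv_pow.simps)
    finally show "Poly_Mapping.lookup (?t m) ?w =
        of_nat (if forced_breaks a m \<zeta> = {} then card (break_sets k m b \<zeta>) else 0)"
      by (simp del: conv_pow.simps)
  qed simp
  also have "\<dots> = of_nat (card (break_sets (Suc k) a b \<zeta>))"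
    by (simp add: card_break_sets_Suc)
  finally show ?case .
qed

section \<open>The alternating sum over break sets\<close>

text \<open>
  This is the Beta integral \<open>\<integral>\<^sub>0\<^sup>1 (- x)\<^sup>d (1 - x)\<^sup>e dx\<close> with \<open>e = |E|\<close>, in which the second factor is
  expanded over the subsets of \<open>E\<close>. Splitting the subsets by whether they contain a given element, that
  is writing \<open>(1 - x)\<^sup>e\<^sup>+\<^sup>1 = (1 - x)\<^sup>e - x (1 - x)\<^sup>e\<close>, gives the induction.
\<close>
lemma alternating_sum_Pow:
  assumes "finite E"
  shows "(\<Sum>D\<in>Pow E. (- 1) ^ (d + card D) / of_nat (Suc (d + card D)) :: 'k::field_char_0) =
    (- 1) ^ d * fact d * fact (card E) / fact (Suc (d + card E))"
  using assms
proof (induction E arbitrary: d rule: finite_induct)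
  case empty
  then show ?case by (simp add: divide_simps del: of_nat_Suc)
next
  case (insert x E)
  let ?f = "\<lambda>d D. (- 1) ^ (d + card D) / of_nat (Suc (d + card D)) :: 'k"
  have "(\<Sum>D\<in>Pow (insert x E). ?f d D) = (\<Sum>D\<in>Pow E. ?f d D) + (\<Sum>D\<in>insert x ` Pow E. ?f d D)"
    unfolding Pow_insert using insert.hyps by (intro sum.union_disjoint) auto
  also have "(\<Sum>D\<in>insert x ` Pow E. ?f d D) = (\<Sum>D\<in>Pow E. ?f (Suc d) D)"
  proof (subst sum.reindex)
    show "inj_on (insert x) (Pow E)"
      using insert.hyps by (auto simp: inj_on_def insert_ident)
    have "card (insert x D) = Suc (card D)" if "D \<in> Pow E" for D
      using that insert.hyps by (auto intro!: card_insert_disjoint finite_subset[of D E])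
    then show "sum (?f d \<circ> insert x) (Pow E) = (\<Sum>D\<in>Pow E. ?f (Suc d) D)"
      by (intro sum.cong) (auto simp del: of_nat_Suc)
  qed
  also have "(\<Sum>D\<in>Pow E. ?f d D) + (\<Sum>D\<in>Pow E. ?f (Suc d) D) =
      (- 1) ^ d * fact d * fact (card E) / fact (Suc (d + card E))
    + (- 1) ^ Suc d * fact (Suc d) * fact (card E) / fact (Suc (Suc d + card E))"
    by (simp only: insert.IH)
  also have "\<dots> = (- 1) ^ d * fact d * fact (card E) *
      (of_nat (Suc (Suc (d + card E))) - of_nat (Suc d)) / fact (Suc (Suc (d + card E)))"
  proof -
    have "fact (Suc (Suc (d + card E))) = (of_nat (Suc (Suc (d + card E))) * fact (Suc (d + card E)) :: 'k)"
      by (rule fact_Suc)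
    moreover have "fact (Suc d) = (of_nat (Suc d) * fact d :: 'k)" by (rule fact_Suc)
    moreover have "of_nat (Suc (Suc (d + card E))) \<noteq> (0 :: 'k)" "fact (Suc (d + card E)) \<noteq> (0 :: 'k)"
      by (simp_all del: of_nat_Suc)
    ultimately show ?thesis
      by (simp add: divide_simps del: of_nat_Suc fact_Suc) (simp add: algebra_simps del: of_nat_Suc fact_Suc)
  qed
  also have "\<dots> = (- 1) ^ d * fact d * fact (Suc (card E)) / fact (Suc (Suc (d + card E)))"
  proof -
    have "of_nat (Suc (Suc (d + card E))) - of_nat (Suc d) = (of_nat (Suc (card E)) :: 'k)"
      by simp
    moreover have "fact (Suc (card E)) = (of_nat (Suc (card E)) * fact (card E) :: 'k)"
      by (rule fact_Suc)
    ultimately show ?thesis by (simp only: mult.assoc mult.commute mult.left_commute)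
  qed
  finally show ?case
    using insert.hyps by (simp del: of_nat_Suc fact_Suc)
qed

text \<open>
  The sets counted with weight \<open>(- 1)\<^sup>k / (k + 1)\<close> are those between the forced breaks and the set of
  all possible breaks, which is a translate of a power set.
\<close>
lemma sum_break_sets:
  assumes "a < b"
  shows "(\<Sum>k<b - a. (- 1) ^ k / of_nat (Suc k) * of_nat (card (break_sets k a b \<zeta>)) :: 'k::field_char_0) =
    (- 1) ^ card (forced_breaks a b \<zeta>) / of_nat (b - a)
      * inverse (of_nat ((b - a - 1) choose card (forced_breaks a b \<zeta>)))"
proof -
  let ?F = "forced_breaks a b \<zeta>"
  let ?U = "{a<..<b}"
  define d where "d = card ?F"
  have F: "?F \<subseteq> ?U" by (auto simp: forced_breaks_def)
  have finF: "finite ?F" using F by (rule finite_subset) simp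
  define S where "S = {D. ?F \<subseteq> D \<and> D \<subseteq> ?U}"
  have finS: "finite S" by (rule finite_subset[of _ "Pow ?U"]) (auto simp: S_def)
  have break_S: "break_sets k a b \<zeta> = {D \<in> S. card D = k}" for k
    by (auto simp: break_sets_def S_def)
  let ?g = "\<lambda>k. (- 1) ^ k / of_nat (Suc k) :: 'k"
  have "(\<Sum>k<b - a. ?g k * of_nat (card (break_sets k a b \<zeta>))) =
      (\<Sum>k<b - a. \<Sum>D\<in>{D \<in> S. card D = k}. ?g (card D))"
    unfolding break_S by (intro sum.cong) (simp_all add: mult.commute)
  also have "\<dots> = (\<Sum>D\<in>S. ?g (card D))"
  proof (rule sum.group[OF finS])
    have "card D < b - a" if "D \<in> S" for D
    proof -
      have "card D \<le> card ?U" using that by (intro card_mono) (auto simp: S_def)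
      then show ?thesis using assms by simp
    qed
    then show "card ` S \<subseteq> {..<b - a}" by auto
  qed simp
  also have "\<dots> = (\<Sum>E\<in>Pow (?U - ?F). ?g (d + card E))"
  proof (rule sum.reindex_bij_witness[of _ "\<lambda>E. ?F \<union> E" "\<lambda>D. D - ?F"])
    fix D assume D: "D \<in> S"
    then have "finite D" by (auto simp: S_def intro: finite_subset[of D ?U])
    then have "card D = d + card (D - ?F)"
      using D finF card_mono[of D ?F] by (auto simp: S_def d_def card_Diff_subset)
    then show "?g (d + card (D - ?F)) = ?g (card D)" by simp
  qed (use F in \<open>auto simp: S_def\<close>)
  also have "\<dots> = (- 1) ^ d * fact d * fact (card (?U - ?F)) / fact (Suc (d + card (?U - ?F)))"
    by (rule alternating_sum_Pow) simp
  also have "card (?U - ?F) = b - a - 1 - d"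
    using F finF by (simp add: card_Diff_subset d_def)
  also have "Suc (d + (b - a - 1 - d)) = b - a"
    using card_mono[OF _ F] assms by (simp add: d_def)
  also have "(- 1) ^ d * fact d * fact (b - a - 1 - d) / fact (b - a) =
      (- 1) ^ d / of_nat (b - a) * inverse (of_nat ((b - a - 1) choose d) :: 'k)"
  proof -
    have "d \<le> b - a - 1" using card_mono[OF _ F] by (simp add: d_def)
    then have "of_nat ((b - a - 1) choose d) = (fact (b - a - 1) / (fact d * fact (b - a - 1 - d)) :: 'k)"
      by (rule binomial_fact)
    moreover have "fact (b - a) = (of_nat (b - a) * fact (b - a - 1) :: 'k)"
      using assms by (intro fact_reduce) simp
    ultimately show ?thesis using assms by simp
  qed
  finally show ?thesis by (simp add: d_def)
qed

section \<open>The logarithm as a sum over surjections\<close>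

text \<open>
  Only the first \<open>length w\<close> convolution powers contribute, as a word cannot be cut into more nonempty
  factors than it has letters.
\<close>
lemma lookup_log_id:
  "Poly_Mapping.lookup (log_id w :: ('a::ab_semigroup_add, 'k::field_char_0) ncpoly) v =
    (\<Sum>k<length w. (- 1) ^ k / of_nat (Suc k) * Poly_Mapping.lookup (conv_pow J (Suc k) w) v)"
proof -
  let ?t = "\<lambda>k. if k \<ge> 1 then scale ((- 1) ^ (k - 1) / of_nat k) (conv_pow J k w) else (0 :: ('a, 'k) ncpoly)"
  have zero: "?t k = 0" if "k \<notin> Suc ` {..<length w}" for k
  proof (cases k)
    case (Suc j)
    with that have "length w < k" by auto
    then show ?thesis by (simp add: conv_pow_J_eq_0)
  qed simp
  then have "log_id w = (\<Sum>k\<in>Suc ` {..<length w}. ?t k)"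
    unfolding log_id_def by (intro Sum_any.expand_superset) (simp, use zero in blast)
  also have "\<dots> = (\<Sum>k<length w. ?t (Suc k))" by (simp add: sum.reindex)
  finally show ?thesis
    by (simp add: lookup_sum lookup_scale del: conv_pow.simps of_nat_Suc)
qed

lemma card_quasi_descents: "card (quasi_descents p \<zeta>) = card (forced_breaks 1 (Suc p) \<zeta>)"
proof -
  have "forced_breaks 1 (Suc p) \<zeta> = Suc ` quasi_descents p \<zeta>"
  proof (intro equalityI subsetI)
    fix c assume "c \<in> forced_breaks 1 (Suc p) \<zeta>"
    then show "c \<in> Suc ` quasi_descents p \<zeta>"
      by (intro image_eqI[of _ _ "c - 1"]) (auto simp: forced_breaks_def quasi_descents_def)
  qed (auto simp: forced_breaks_def quasi_descents_def)
  then show ?thesis by (simp add: card_image)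
qed

lemma quasi_perm_eq_block_word:
  assumes "\<zeta> \<in> surjections p"
  shows "quasi_perm p \<zeta> = block_word {1..p} \<zeta>"
proof -
  obtain q where "\<zeta> ` {1..p} = {1..q}" using assms by (auto simp: surjections_def)
  then show ?thesis by (simp only: block_word_image quasi_perm_def card_atLeastAtMost diff_Suc_1)
qed

lemma bij_betw_quasi_perm:
  "bij_betw (quasi_perm p) (surjections p) {w. content w = mset_set {1..p}}"
  unfolding bij_betw_def
proof
  show "inj_on (quasi_perm p) (surjections p)"
  proof (rule inj_onI)
    fix \<zeta> \<xi> assume *: "\<zeta> \<in> surjections p" "\<xi> \<in> surjections p" "quasi_perm p \<zeta> = quasi_perm p \<xi>"
    then obtain q r where "\<zeta> ` {1..p} = {1..q}" "\<xi> ` {1..p} = {1..r}"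
      by (auto simp: surjections_def)
    with * show "\<zeta> = \<xi>"
      by (intro block_word_inj[of "{1..p}" \<zeta> \<xi> q r]) (auto simp: quasi_perm_eq_block_word surjections_def)
  qed
  show "quasi_perm p ` surjections p = {w. content w = mset_set {1..p}}"
  proof (intro equalityI subsetI)
    fix w assume "w \<in> quasi_perm p ` surjections p"
    then show "w \<in> {w. content w = mset_set {1..p}}"
      by (auto simp: quasi_perm_eq_block_word content_block_word)
  next
    fix w assume "w \<in> {w. content w = mset_set {1..p}}"
    then obtain \<zeta> where \<zeta>: "\<zeta> \<in> extensional {1..p}" "\<zeta> ` {1..p} = {1..length w}"
        "block_word {1..p} \<zeta> = w"
      using block_word_surj[of "{1..p}" w] by auto
    have "length w \<le> p" using card_image_le[of "{1..p}" \<zeta>] \<zeta>(2) by simp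
    with \<zeta> have "\<zeta> \<in> surjections p" unfolding surjections_def by blast
    with \<zeta>(3) show "w \<in> quasi_perm p ` surjections p"
      by (metis image_eqI quasi_perm_eq_block_word)
  qed
qed

lemma finite_surjections: "finite (surjections p)"
proof (rule finite_subset)
  show "surjections p \<subseteq> {1..p} \<rightarrow>\<^sub>E {1..p}"
  proof
    fix \<zeta> assume "\<zeta> \<in> surjections p"
    then obtain q where "\<zeta> \<in> extensional {1..p}" "q \<le> p" "\<zeta> ` {1..p} = {1..q}"
      by (auto simp: surjections_def)
    then show "\<zeta> \<in> {1..p} \<rightarrow>\<^sub>E {1..p}"
      unfolding PiE_def by (fastforce simp: image_subset_iff_funcset[symmetric])
  qed
qed (simp add: finite_PiE)

theorem corollary7:
  fixes p :: nat
  assumes "p \<ge> 1"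
  shows "(log_id (map gen [1..<Suc p]) :: (nat letter, 'k::field_char_0) ncpoly) =
    (\<Sum>\<zeta>\<in>surjections p.
       scale ((- 1) ^ card (quasi_descents p \<zeta>) / of_nat p
           * inverse (of_nat ((p - 1) choose card (quasi_descents p \<zeta>))))
         (word (quasi_perm p \<zeta>)))"
proof (rule poly_mapping_eqI)
  fix w
  let ?u = "map gen [1..<Suc p] :: nat letter list"
  let ?c = "\<lambda>\<zeta>. (- 1) ^ card (quasi_descents p \<zeta>) / of_nat p
           * inverse (of_nat ((p - 1) choose card (quasi_descents p \<zeta>))) :: 'k"
  have rhs: "Poly_Mapping.lookup (\<Sum>\<zeta>\<in>surjections p. scale (?c \<zeta>) (word (quasi_perm p \<zeta>))) w
      = (\<Sum>\<zeta>\<in>surjections p. if quasi_perm p \<zeta> = w then ?c \<zeta> else 0)"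
    unfolding lookup_sum lookup_scale lookup_single by (intro sum.cong) (auto simp: when_def)
  have lhs: "Poly_Mapping.lookup (log_id ?u :: (nat letter, 'k) ncpoly) w =
      (\<Sum>k<p. (- 1) ^ k / of_nat (Suc k) * Poly_Mapping.lookup (conv_pow J (Suc k) ?u) w)"
    using lookup_log_id[of ?u w] by (simp del: upt_Suc of_nat_Suc conv_pow.simps)
  show "Poly_Mapping.lookup (log_id ?u :: (nat letter, 'k) ncpoly) w =
    Poly_Mapping.lookup (\<Sum>\<zeta>\<in>surjections p. scale (?c \<zeta>) (word (quasi_perm p \<zeta>))) w"
  proof (cases "content w = mset_set {1..p}")
    case True
    then have "w \<in> quasi_perm p ` surjections p"
      unfolding bij_betw_imp_surj_on[OF bij_betw_quasi_perm] by simp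
    then obtain \<zeta> where \<zeta>: "\<zeta> \<in> surjections p" "quasi_perm p \<zeta> = w"
      by auto
    have "quasi_perm p \<xi> = w \<longleftrightarrow> \<xi> = \<zeta>" if "\<xi> \<in> surjections p" for \<xi>
      using inj_onD[OF bij_betw_imp_inj_on[OF bij_betw_quasi_perm], of p \<xi> \<zeta>] \<zeta> that by auto
    then have "(\<Sum>\<xi>\<in>surjections p. if quasi_perm p \<xi> = w then ?c \<xi> else 0) =
        (\<Sum>\<xi>\<in>surjections p. if \<xi> = \<zeta> then ?c \<xi> else 0)"
      by (intro sum.cong) auto
    also have "\<dots> = ?c \<zeta>" using \<zeta>(1) finite_surjections by simp
    also have "\<dots> = (\<Sum>k<p. (- 1) ^ k / of_nat (Suc k) * of_nat (card (break_sets k 1 (Suc p) \<zeta>)))"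
      using sum_break_sets[of 1 "Suc p" \<zeta>, where 'k = 'k] assms
      by (simp add: card_quasi_descents del: of_nat_Suc)
    also have "\<dots> = Poly_Mapping.lookup (log_id ?u :: (nat letter, 'k) ncpoly) w"
    proof -
      have w: "w = block_word {1..<Suc p} \<zeta>"
        using \<zeta> quasi_perm_eq_block_word by (simp add: atLeastLessThanSuc_atLeastAtMost)
      show ?thesis
        unfolding lhs unfolding w
        by (intro sum.cong refl) (subst lookup_conv_pow_J, use assms in simp_all)
    qed
    finally show ?thesis unfolding rhs by simp
  next
    case False
    have "Poly_Mapping.lookup (conv_pow J k ?u :: (nat letter, 'k) ncpoly) w = 0" for k
    proof (rule ccontr)
      assume "Poly_Mapping.lookup (conv_pow J k ?u :: (nat letter, 'k) ncpoly) w \<noteq> 0"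
      then have "content w = mset_set {1..<Suc p}"
        by (intro content_conv_pow_J[of 1 "Suc p" w k]) (simp_all add: in_keys_iff del: upt_Suc)
      with False show False by (simp add: atLeastLessThanSuc_atLeastAtMost)
    qed
    moreover have "quasi_perm p \<zeta> \<noteq> w" if "\<zeta> \<in> surjections p" for \<zeta>
      using bij_betwE[OF bij_betw_quasi_perm[of p]] that False by auto
    ultimately show ?thesis unfolding lhs rhs by (simp del: conv_pow.simps upt_Suc)
  qed
qed

end
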